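(* Let $0<p\le1/2$, $s\in[1/2,1]$, $\epsilon_1>0$, and for each $m$ let $n=n(m)\ge(1+\epsilon_1)\,m\log(1/p)$. Let the number of users be $M=2^{H(s)m-1}$ (read as $\max\{1,\lfloor 2^{H(s)m-1}\rfloor\}$), let the key of the strongly universal set of hash functions $H_{g(\underline k)}(i)=k_i$ be drawn i.i.d. Bernoulli$(p)$, and let bins be allocated to the users by the backdoor mechanism described in the context. Then the average guesswork under a remote attack satisfies $$ \lim_{m\to\infty}\frac1m\log E(G_{remote}(B))=\begin{cases}H(s)+D(s\|p), & 1-p\le s\le 1,\\ 2H(p)+D(1-p\|p)-H(s), & 1/2\le s\le 1-p.\end{cases} $$
   Context: Logarithms are base 2. $H(q)=-q\log q-(1-q)\log(1-q)$ and $D(q\|p)=q\log\frac qp+(1-q)\log\frac{1-q}{1-p}$ (with $0\log 0=0$). The key $\underline k=(k_1,\dots,k_{2^n})$ consists of $2^n$ segments of $m$ bits, and the hash function with this key maps input $i\in\{1,\dots,2^n\}$ to the bin $H_{g(\underline k)}(i)=k_i\in\{0,1\}^m\cong\{1,\dots,2^m\}$. All $m2^n$ key bits are i.i.d. Bernoulli$(p)$ (probability $p$ of a one); $P_K(b)$ denotes the probability of $b\in\{0,1\}^m$ under i.i.d. Bernoulli$(p)$ bits. Backdoor mechanism: order the bins $b_1,b_2,\dots$ from least likely (w.r.t. $P_K$; the all-ones bin is first) upward, and allocate $b_i$ to user $i$, $1\le i\le M$. Each user independently draws a password uniformly from $\{1,\dots,2^n\}$ (independently of the key). If the drawn number $g$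 has not been drawn by any user whose allocated bin is less likely, the key segment $k_g$ is replaced by the bin allocated to this user. If another user with a less likely bin has drawn $g$, then $k_g$ is not changed again; instead the bin of the user is changed to the least likely bin among the bins allocated to users whose password is $g$. Remote attack: the attacker, not knowing the key, guesses inputs one by one in any fixed order, without repetition, until it guesses an input mapped (by the modified key) to the bin of the attacked user. $E(G_{remote}(B))$ is the expected number of guesses (over key and passwords), averaged over the $M$ users. *)

theory Defs
  imports "HOL-Probability.Probability"
begin

text \<open>The convention \<open>0 log 0 = 0\<close> holds since \<open>log 2\<close> is total and the factor in front of it vanishes.\<close>

definition bin_entropy :: "real \<Rightarrow> real" where
  "bin_entropy q = - q * log 2 q - (1 - q) * log 2 (1 - q)"

definition bin_divergence :: "real \<Rightarrow> real \<Rightarrow> real" where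
  "bin_divergence q p = q * log 2 (q / p) + (1 - q) * log 2 ((1 - q) / (1 - p))"

text \<open>
  Bins, and the segments of a key, are bit strings of length \<open>m\<close>, i.e. elements of \<open>bins m\<close>.
  Inputs and passwords are numbers in \<open>{1..2 ^ n}\<close>; users are numbers in \<open>{1..M}\<close>.
\<close>

definition bins :: "nat \<Rightarrow> bool list set" where
  "bins m = {xs. length xs = m}"

definition segment_pmf :: "nat \<Rightarrow> real \<Rightarrow> bool list pmf" where
  "segment_pmf m p = replicate_pmf m (bernoulli_pmf p)"

definition P_K :: "nat \<Rightarrow> real \<Rightarrow> bool list \<Rightarrow> real" where
  "P_K m p b = pmf (segment_pmf m p) b"

definition key_pmf :: "nat \<Rightarrow> nat \<Rightarrow> real \<Rightarrow> (nat \<Rightarrow> bool list) pmf" where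
  "key_pmf n m p = Pi_pmf {1..2 ^ n} [] (\<lambda>_. segment_pmf m p)"

definition password_pmf :: "nat \<Rightarrow> nat \<Rightarrow> (nat \<Rightarrow> nat) pmf" where
  "password_pmf n M = Pi_pmf {1..M} 0 (\<lambda>_. pmf_of_set {1..2 ^ n})"

definition hash :: "(nat \<Rightarrow> bool list) \<Rightarrow> nat \<Rightarrow> bool list" where
  "hash k i = k i"

definition num_users :: "real \<Rightarrow> nat \<Rightarrow> nat" where
  "num_users s m = max 1 (nat \<lfloor>2 powr (bin_entropy s * real m - 1)\<rfloor>)"

text \<open>Enumerations of all bins from least likely upward; ties are broken arbitrarily.\<close>

definition bin_ordering :: "nat \<Rightarrow> real \<Rightarrow> (nat \<Rightarrow> bool list) \<Rightarrow> bool" where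
  "bin_ordering m p b \<longleftrightarrow>
     bij_betw b {1..2 ^ m} (bins m) \<and> mono_on {1..2 ^ m} (\<lambda>i. P_K m p (b i))"

text \<open>
  User \<open>u\<close> is allocated the bin \<open>b u\<close>, so among users the one with the least likely bin is the one
  with the smallest number. Hence a segment whose index \<open>j\<close> was drawn by somebody finally holds the
  bin allocated to the first user who drew \<open>j\<close>, and that is also the final bin of every
  user who drew \<open>j\<close>.
\<close>

definition backdoor_key ::
    "nat \<Rightarrow> (nat \<Rightarrow> bool list) \<Rightarrow> (nat \<Rightarrow> nat) \<Rightarrow> (nat \<Rightarrow> bool list) \<Rightarrow> nat \<Rightarrow> bool list" where
  "backdoor_key M b g k j =
     (if j \<in> g ` {1..M} then b (Min {u \<in> {1..M}. g u = j}) else k j)"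

definition user_bin ::
    "nat \<Rightarrow> (nat \<Rightarrow> bool list) \<Rightarrow> (nat \<Rightarrow> nat) \<Rightarrow> nat \<Rightarrow> bool list" where
  "user_bin M b g u = b (Min {v \<in> {1..M}. g v = g u})"

text \<open>
  Number of guesses of an attacker who tries the inputs \<open>\<sigma> 1, \<sigma> 2, \<dots>\<close> in turn, until an input
  is mapped to the bin \<open>c\<close>.
\<close>

definition guesses :: "(nat \<Rightarrow> nat) \<Rightarrow> (nat \<Rightarrow> bool list) \<Rightarrow> bool list \<Rightarrow> nat" where
  "guesses \<sigma> k c = (LEAST t. 1 \<le> t \<and> hash k (\<sigma> t) = c)"

definition avg_guesswork_remote ::
    "nat \<Rightarrow> nat \<Rightarrow> real \<Rightarrow> nat \<Rightarrow> (nat \<Rightarrow> bool list) \<Rightarrow> (nat \<Rightarrow> nat) \<Rightarrow> real" where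
  "avg_guesswork_remote n m p M b \<sigma> =
     (\<Sum>u = 1..M.
        measure_pmf.expectation (pair_pmf (key_pmf n m p) (password_pmf n M))
          (\<lambda>(k, g). real (guesses \<sigma> (backdoor_key M b g k) (user_bin M b g u)))) / real M"

end

theory Submission
  imports Defs "HOL-Real_Asymp.Real_Asymp"
begin

text \<open>
  If the bin of a user has probability \<open>\<pi>\<close>, the attacker needs about \<open>1 / \<pi>\<close> guesses: the key is so
  long that the replaced segments hardly shorten the search, and they prolong it by at most \<open>M\<close>
  guesses. So the average guesswork agrees up to constant factors with the average \<open>A\<close> of
  \<open>1 / \<pi>\<close> over the allocated bins, which is itself at least \<open>M\<close> because the probabilities sum to at
  most one. A bin with a fraction \<open>q\<close> of ones has \<open>1 / \<pi> = 2 powr (m * (H(q) + D(q\<parallel>p)))\<close>, and there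
  are about \<open>2 powr (m * H(q))\<close> such bins; among the \<open>M\<close> least likely bins the contribution with
  exponent \<open>2 H(q) + D(q\<parallel>p)\<close> is maximal at \<open>q = max s (1 - p)\<close>. The upper bound for the sum is
  obtained by a change of measure to Bernoulli(\<open>q\<close>).
\<close>

subsection \<open>Bins, keys and passwords\<close>

definition ones :: "bool list \<Rightarrow> nat" where
  "ones xs = length (filter id xs)"

lemma ones_simps [simp]: "ones [] = 0" "ones (x # xs) = (if x then Suc (ones xs) else ones xs)"
  by (auto simp: ones_def)

lemma ones_le_length: "ones xs \<le> length xs"
  by (simp add: ones_def)

lemma finite_bins: "finite (bins m)"
  using finite_lists_length_eq[of "UNIV :: bool set" m] by (simp add: bins_def)

lemma P_K_eq:
  assumes "0 \<le> q" "q \<le> 1" "x \<in> bins m"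
  shows "P_K m q x = q ^ ones x * (1 - q) ^ (m - ones x)"
proof -
  have "pmf (replicate_pmf (length x) (bernoulli_pmf q)) x = q ^ ones x * (1 - q) ^ (length x - ones x)"
    for x
  proof (induction x)
    case (Cons y x)
    \<comment> \<open>The evaluation point is displayed as an image under the injective map
      \<open>\<lambda>(y, x). y # x\<close>, so that \<open>pmf_map_inj'\<close> passes to the
      pair.\<close>
    have "pmf (replicate_pmf (length (y # x)) (bernoulli_pmf q)) (y # x) =
      pmf (map_pmf (\<lambda>(y, x). y # x)
        (pair_pmf (bernoulli_pmf q) (replicate_pmf (length x) (bernoulli_pmf q)))) (case (y, x) of (y, x) \<Rightarrow> y # x)"
      by (simp add: pair_pmf_def map_pmf_def bind_assoc_pmf bind_return_pmf)
    also have "\<dots> = pmf (bernoulli_pmf q) y * pmf (replicate_pmf (length x) (bernoulli_pmf q)) x"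
      by (subst pmf_map_inj') (auto simp: inj_def pmf_pair)
    also have "\<dots> = q ^ ones (y # x) * (1 - q) ^ (length (y # x) - ones (y # x))"
      using assms(1,2) ones_le_length[of x]
      by (cases y) (auto simp: Cons.IH Suc_diff_le)
    finally show ?case .
  qed simp
  from this[of x] assms(3) show ?thesis
    by (simp add: P_K_def segment_pmf_def bins_def)
qed

lemma sum_P_K_le_1: "finite A \<Longrightarrow> (\<Sum>x\<in>A. P_K m q x) \<le> 1"
  unfolding P_K_def by (metis measure_measure_pmf_finite measure_pmf.prob_le_1)

lemma P_K_le_1: "P_K m q x \<le> 1"
  by (simp add: P_K_def pmf_le_1)

lemma card_bins_ones: "card {x \<in> bins m. ones x = w} = m choose w"
proof (induction m arbitrary: w)
  case 0
  have *: "{x \<in> bins 0. ones x = w} = (if w = 0 then {[]} else {})"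
    by (auto simp: bins_def)
  show ?case
    unfolding * by (cases w) auto
next
  case (Suc m)
  have fin: "finite {x \<in> bins m. ones x = v}" for v
    using finite_bins by simp
  show ?case
  proof (cases w)
    case 0
    have "{x \<in> bins (Suc m). ones x = w} = (#) False ` {x \<in> bins m. ones x = 0}"
      using 0 by (auto simp: bins_def length_Suc_conv split: if_splits)
    then show ?thesis using 0 Suc[of 0] by (simp add: card_image)
  next
    case (Suc v)
    have "{x \<in> bins (Suc m). ones x = w} =
        (#) False ` {x \<in> bins m. ones x = Suc v} \<union> (#) True ` {x \<in> bins m. ones x = v}"
      using Suc by (auto simp: bins_def length_Suc_conv image_iff split: if_splits)
    moreover have "(#) False ` {x \<in> bins m. ones x = Suc v} \<inter> (#) True ` {x \<in> bins m. ones x = v} = {}"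
      by auto
    ultimately show ?thesis
      using fin Suc Suc.IH by (simp add: card_Un_disjoint card_image)
  qed
qed

section \<open>Independent draws of keys and passwords\<close>

text \<open>Finite supports turn the integrals into finite sums, where Fubini is an exchange of
  summation. The second component is outermost because the attack is analysed for fixed passwords
  first.\<close>

lemma expectation_pair_pmf:
  fixes f :: "'a \<times> 'b \<Rightarrow> real"
  assumes "finite (set_pmf A)" "finite (set_pmf B)"
  shows "measure_pmf.expectation (pair_pmf A B) f =
    measure_pmf.expectation B (\<lambda>y. measure_pmf.expectation A (\<lambda>x. f (x, y)))"
proof -
  have "measure_pmf.expectation (pair_pmf A B) f =
    (\<Sum>(x, y)\<in>set_pmf A \<times> set_pmf B. f (x, y) * (pmf A x * pmf B y))"
    using assms by (subst integral_measure_pmf_real[where A = "set_pmf A \<times> set_pmf B"])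
      (auto simp: pmf_pair intro!: sum.cong)
  also have "\<dots> = (\<Sum>y\<in>set_pmf B. \<Sum>x\<in>set_pmf A. f (x, y) * (pmf A x * pmf B y))"
    by (subst sum.cartesian_product[symmetric], rule sum.swap)
  also have "\<dots> = (\<Sum>y\<in>set_pmf B. (\<Sum>x\<in>set_pmf A. f (x, y) * pmf A x) * pmf B y)"
    by (simp add: sum_distrib_left sum_distrib_right mult_ac)
  also have "\<dots> = measure_pmf.expectation B (\<lambda>y. measure_pmf.expectation A (\<lambda>x. f (x, y)))"
    using assms by (subst integral_measure_pmf_real[where A = "set_pmf B"])
      (auto intro!: sum.cong simp: integral_measure_pmf_real[where A = "set_pmf A"])
  finally show ?thesis .
qed

lemma finite_set_Pi_pmf:
  assumes "finite A" "\<And>x. x \<in> A \<Longrightarrow> finite (set_pmf (p x))"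
  shows "finite (set_pmf (Pi_pmf A dflt p))"
  using assms by (auto simp: set_Pi_pmf intro!: finite_PiE_dflt)

lemma finite_set_key_pmf: "finite (set_pmf (key_pmf n m p))"
  unfolding key_pmf_def
proof (rule finite_set_Pi_pmf)
  have "set_pmf (segment_pmf m p) \<subseteq> bins m"
    by (auto simp: segment_pmf_def set_replicate_pmf bins_def)
  then show "finite (set_pmf (segment_pmf m p))"
    using finite_bins finite_subset by blast
qed auto

lemma finite_set_password_pmf: "finite (set_pmf (password_pmf n M))"
  unfolding password_pmf_def by (rule finite_set_Pi_pmf) auto

lemma password_in_range:
  assumes "g \<in> set_pmf (password_pmf n M)" "u \<in> {1..M}"
  shows "g u \<in> {1..2 ^ n}"
  using assms by (auto simp: password_pmf_def set_Pi_pmf PiE_dflt_def)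

text \<open>Independence of the segments: the event is a product in which the segments in
  \<open>J\<close> have to miss \<open>c\<close> and all others are free.\<close>

lemma prob_key_avoids:
  assumes "J \<subseteq> {1..2 ^ n}"
  shows "measure_pmf.prob (key_pmf n m p) {k. \<forall>j\<in>J. k j \<noteq> c} = (1 - P_K m p c) ^ card J"
proof -
  have "{k. \<forall>j\<in>J. k j \<noteq> c} = Pi {1..2 ^ n} (\<lambda>j. if j \<in> J then - {c} else UNIV)"
    using subsetD[OF assms] by (fastforce simp: Pi_def split: if_splits)
  then have "measure_pmf.prob (key_pmf n m p) {k. \<forall>j\<in>J. k j \<noteq> c} =
    (\<Prod>j\<in>{1..2 ^ n}. measure_pmf.prob (segment_pmf m p) (if j \<in> J then - {c} else UNIV))"
    by (simp add: key_pmf_def measure_Pi_pmf_Pi)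
  also have "\<dots> = (\<Prod>j\<in>{1..2 ^ n}. if j \<in> J then 1 - P_K m p c else 1)"
    using measure_pmf.prob_compl[of "{c}" "segment_pmf m p"]
    by (intro prod.cong) (auto simp: P_K_def measure_pmf_single Compl_eq_Diff_UNIV)
  also have "\<dots> = (1 - P_K m p c) ^ card J"
    using assms by (subst prod.inter_restrict[symmetric]) (auto simp: Int_absorb1)
  finally show ?thesis .
qed

lemma prob_password_in:
  assumes "u \<in> {1..M}" "J \<subseteq> {1..2 ^ n}"
  shows "measure_pmf.prob (password_pmf n M) {g. g u \<in> J} = real (card J) / 2 ^ n"
proof -
  have "measure_pmf.prob (password_pmf n M) {g. g u \<in> J} =
      measure_pmf.prob (map_pmf (\<lambda>g. g u) (password_pmf n M)) J"
    by (simp add: vimage_def)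
  also have "\<dots> = measure_pmf.prob (pmf_of_set {1..2 ^ n}) J"
    using assms by (simp add: password_pmf_def Pi_pmf_component)
  also have "\<dots> = real (card J) / 2 ^ n"
    using assms by (subst measure_pmf_of_set) (auto simp: Int_absorb1)
  finally show ?thesis .
qed

text \<open>A union bound over the common password: there are \<open>2 ^ n\<close> candidates, and
  independence gives each of them probability \<open>1 / 2 ^ n * (1 / 2 ^ n)\<close>.\<close>

lemma prob_password_collision:
  assumes "u \<in> {1..M}" "v \<in> {1..M}" "u \<noteq> v"
  shows "measure_pmf.prob (password_pmf n M) {g. g v = g u} \<le> 1 / 2 ^ n"
proof -
  have range: "measure_pmf.prob (pmf_of_set {1..2 ^ n}) {j} = 1 / 2 ^ n"
    if "j \<in> {1..2 ^ n}" for j :: nat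
    using that by (subst measure_pmf_of_set) auto
  have prod: "measure_pmf.prob (password_pmf n M) {g. g u = j \<and> g v = j} = 1 / 2 ^ n * (1 / 2 ^ n)"
    if "j \<in> {1..2 ^ n}" for j
  proof -
    have "{g. g u = j \<and> g v = j} = Pi {1..M} (\<lambda>w. if w \<in> {u, v} then {j} else UNIV)"
      using assms by (auto simp: Pi_def)
    then have "measure_pmf.prob (password_pmf n M) {g. g u = j \<and> g v = j} =
       (\<Prod>w\<in>{1..M}. measure_pmf.prob (pmf_of_set {1..2 ^ n}) (if w \<in> {u, v} then {j} else UNIV))"
      by (simp add: password_pmf_def measure_Pi_pmf_Pi)
    also have "\<dots> = (\<Prod>w\<in>{1..M}. if w \<in> {u, v} then 1 / 2 ^ n else 1)"
      using range[OF that] by (intro prod.cong) auto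
    also have "\<dots> = (\<Prod>w\<in>{1..M} \<inter> {u, v}. 1 / 2 ^ n)"
      by (subst prod.inter_restrict[symmetric]) auto
    also have "{1..M} \<inter> {u, v} = {u, v}"
      using assms by auto
    finally show ?thesis using assms(3) by simp
  qed
  \<comment> \<open>Passing to the support confines the common value to \<open>{1..2 ^ n}\<close>,
    the range of the union below.\<close>
  have "measure_pmf.prob (password_pmf n M) {g. g v = g u} =
      measure_pmf.prob (password_pmf n M) ({g. g v = g u} \<inter> set_pmf (password_pmf n M))"
    by (simp add: measure_Int_set_pmf)
  also have "\<dots> \<le> measure_pmf.prob (password_pmf n M) (\<Union>j\<in>{1..2 ^ n}. {g. g u = j \<and> g v = j})"
    using password_in_range[OF _ assms(1)]
    by (intro measure_pmf.finite_measure_mono) auto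
  also have "\<dots> \<le> (\<Sum>j\<in>{1..2 ^ n}. measure_pmf.prob (password_pmf n M) {g. g u = j \<and> g v = j})"
    by (rule measure_pmf.finite_measure_subadditive_finite) auto
  also have "\<dots> = 1 / 2 ^ n"
    using prod by simp
  finally show ?thesis .
qed

text \<open>Truncated subtraction makes the first \<open>M\<close> summands equal to 1; what follows
  is a geometric series. The delay \<open>M\<close> will account for guesses spent on replaced
  segments.\<close>

lemma sum_geometric_delayed_le:
  fixes x :: real
  assumes "0 < x" "x \<le> 1"
  shows "(\<Sum>t<N. (1 - x) ^ (t - M)) \<le> real M + 1 / x"
proof -
  \<comment> \<open>With \<open>M + N\<close> terms the sum splits at \<open>M\<close> without a
    comparison of \<open>M\<close> and \<open>N\<close>.\<close>
  have "(\<Sum>t<N. (1 - x) ^ (t - M)) \<le> (\<Sum>t<M + N. (1 - x) ^ (t - M))"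
    using assms by (intro sum_mono2) auto
  also have "\<dots> = (\<Sum>t<M. (1 - x) ^ (t - M)) + (\<Sum>t<N. (1 - x) ^ t)"
    by (subst lessThan_atLeast0, subst sum.atLeastLessThan_concat[of 0 M "M + N", symmetric])
      (auto simp: sum.shift_bounds_nat_ivl[of _ 0 M N, simplified add.commute[of _ M] add_0_right] lessThan_atLeast0)
  also have "(\<Sum>t<N. (1 - x) ^ t) = (1 - (1 - x) ^ N) / x"
    using assms by (simp add: sum_gp_strict)
  also have "\<dots> \<le> 1 / x"
    using assms by (intro divide_right_mono) auto
  finally show ?thesis by simp
qed

lemma guesses_le:
  assumes "i \<ge> 1" "hash k (\<sigma> i) = c"
  shows "guesses \<sigma> k c \<le> i"
  unfolding guesses_def using assms by (intro Least_le) auto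

text \<open>The premises exhibit a hit, so the \<open>LEAST\<close> in \<open>guesses\<close> is
  attained.\<close>

lemma less_guesses_iff:
  assumes "i \<ge> 1" "hash k (\<sigma> i) = c"
  shows "t < guesses \<sigma> k c \<longleftrightarrow> (\<forall>i\<in>{1..t}. hash k (\<sigma> i) \<noteq> c)"
proof
  assume "t < guesses \<sigma> k c"
  then show "\<forall>i\<in>{1..t}. hash k (\<sigma> i) \<noteq> c"
    using guesses_le[of _ k \<sigma> c] by fastforce
next
  assume *: "\<forall>i\<in>{1..t}. hash k (\<sigma> i) \<noteq> c"
  have "1 \<le> guesses \<sigma> k c \<and> hash k (\<sigma> (guesses \<sigma> k c)) = c"
    unfolding guesses_def by (rule LeastI) (use assms in blast)
  with * show "t < guesses \<sigma> k c"
    by (meson atLeastAtMost_iff not_le)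
qed

subsection \<open>Reduction to the mean inverse probability\<close>

text \<open>\<open>key_long\<close> is the non-asymptotic form of the condition on the key length:
  there are at least \<open>1 / p ^ m\<close> inputs, so the inverse probability of a bin never
  exceeds the number of inputs.\<close>

locale remote_attack =
  fixes n m M :: nat and p :: real and b :: "nat \<Rightarrow> bool list" and \<sigma> :: "nat \<Rightarrow> nat"
  assumes p_pos: "0 < p" and p_le: "p \<le> 1 / 2"
    and ordering: "bin_ordering m p b"
    and attack_order: "bij_betw \<sigma> {1..2 ^ n} {1..2 ^ n}"
    and M_pos: "1 \<le> M" and M_le: "M \<le> 2 ^ m"
    and key_long: "1 \<le> 2 ^ n * p ^ m"
begin

abbreviation \<pi> :: "nat \<Rightarrow> real" where
  "\<pi> u \<equiv> P_K m p (b u)"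

definition mean_inverse_prob :: real where
  "mean_inverse_prob = (\<Sum>u = 1..M. 1 / \<pi> u) / real M"

definition first_user :: "(nat \<Rightarrow> nat) \<Rightarrow> nat \<Rightarrow> nat" where
  "first_user g u = Min {v \<in> {1..M}. g v = g u}"

lemma user_bin_eq: "user_bin M b g u = b (first_user g u)"
  by (simp add: user_bin_def first_user_def)

lemma first_user:
  assumes "u \<in> {1..M}"
  shows "first_user g u \<in> {1..M}" "first_user g u \<le> u" "g (first_user g u) = g u"
proof -
  have "first_user g u \<in> {v \<in> {1..M}. g v = g u}"
    unfolding first_user_def using assms by (intro Min_in) auto
  then show "first_user g u \<in> {1..M}" "g (first_user g u) = g u" by auto
  show "first_user g u \<le> u"
    unfolding first_user_def using assms by (intro Min_le) auto
qed

lemma bin_in_bins: "u \<in> {1..M} \<Longrightarrow> b u \<in> bins m"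
  using ordering M_le by (fastforce simp: bin_ordering_def bij_betw_def)

lemma inj_on_bins: "inj_on b {1..M}"
  using ordering M_le by (auto simp: bin_ordering_def bij_betw_def intro: inj_on_subset)

lemma prob_mono:
  assumes "u \<in> {1..M}" "v \<in> {1..M}" "u \<le> v"
  shows "\<pi> u \<le> \<pi> v"
  using ordering M_le assms unfolding bin_ordering_def
  by (auto simp: monotone_on_def)

lemma prob_ge:
  assumes "u \<in> {1..M}"
  shows "p ^ m \<le> \<pi> u"
proof -
  have "ones (b u) \<le> m"
    using ones_le_length[of "b u"] bin_in_bins[OF assms] by (simp add: bins_def)
  then have "p ^ m = p ^ ones (b u) * p ^ (m - ones (b u))"
    by (simp flip: power_add)
  also have "\<dots> \<le> p ^ ones (b u) * (1 - p) ^ (m - ones (b u))"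
    using p_pos p_le by (intro mult_left_mono power_mono) auto
  also have "\<dots> = \<pi> u"
    using p_pos p_le bin_in_bins[OF assms] by (simp add: P_K_eq)
  finally show ?thesis .
qed

lemma prob_pos: "u \<in> {1..M} \<Longrightarrow> 0 < \<pi> u"
  using prob_ge[of u] p_pos by (meson less_le_trans zero_less_power)

lemma inverse_prob_le: "u \<in> {1..M} \<Longrightarrow> 1 / \<pi> u \<le> 2 ^ n"
proof -
  assume u: "u \<in> {1..M}"
  have "1 \<le> 2 ^ n * \<pi> u"
    using key_long prob_ge[OF u] by (smt (verit) mult_left_mono zero_le_power)
  then show ?thesis using prob_pos[OF u] by (simp add: field_simps)
qed

text \<open>Since \<open>2 * p \<le> 1\<close>, \<open>key_long\<close> forces
  \<open>2 ^ m \<le> 2 ^ n\<close>. This allows collision probabilities \<open>1 / 2 ^ n\<close> to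
  be compared with the weight \<open>1 / M\<close> of a user in the average.\<close>

lemma M_le_num_inputs: "M \<le> 2 ^ n"
proof -
  have "(2 :: real) ^ m \<le> 2 ^ m * (2 ^ n * p ^ m)"
    using key_long by simp
  also have "\<dots> = 2 ^ n * (2 * p) ^ m"
    by (simp add: power_mult_distrib)
  also have "\<dots> \<le> 2 ^ n * 1"
    using p_pos p_le by (intro mult_left_mono power_le_one) auto
  finally have "(2 :: real) ^ m \<le> 2 ^ n" by simp
  then have "(2 :: nat) ^ m \<le> 2 ^ n" by simp
  with M_le show ?thesis by linarith
qed

text \<open>Cauchy-Schwarz, as the probabilities of the allocated bins sum to at most one.\<close>

lemma M_le_mean_inverse_prob: "real M \<le> mean_inverse_prob"
proof -
  have "(\<Sum>u = 1..M. \<pi> u) = (\<Sum>x\<in>b ` {1..M}. P_K m p x)"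
    using inj_on_bins by (simp add: sum.reindex)
  then have "(\<Sum>u = 1..M. \<pi> u) \<le> 1"
    using sum_P_K_le_1 by simp
  then have "real M ^ 2 * (\<Sum>u = 1..M. \<pi> u) \<le> real M ^ 2 * 1"
    by (intro mult_left_mono) auto
  \<comment> \<open>The tangent to \<open>1 / x\<close> at \<open>x = 1 / M\<close> is
    \<open>2 * M - M ^ 2 * x\<close>; by convexity it lies below the curve.\<close>
  then have "real M ^ 2 \<le> (\<Sum>u = 1..M. 2 * real M - real M ^ 2 * \<pi> u)"
    by (simp add: sum_subtractf sum_distrib_left power2_eq_square)
  also have "\<dots> \<le> (\<Sum>u = 1..M. 1 / \<pi> u)"
  proof (rule sum_mono)
    fix u assume "u \<in> {1..M}"
    then have "0 < \<pi> u" by (rule prob_pos)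
    moreover have "0 \<le> (1 - real M * \<pi> u)\<^sup>2" by simp
    ultimately show "2 * real M - real M ^ 2 * \<pi> u \<le> 1 / \<pi> u"
      by (simp add: field_simps power2_eq_square)
  qed
  finally show ?thesis
    using M_pos by (simp add: mean_inverse_prob_def field_simps power2_eq_square)
qed

section \<open>Guesswork for fixed passwords\<close>

abbreviation key_expectation :: "(nat \<Rightarrow> nat) \<Rightarrow> nat \<Rightarrow> real" where
  "key_expectation g u \<equiv> measure_pmf.expectation (key_pmf n m p)
     (\<lambda>k. real (guesses \<sigma> (backdoor_key M b g k) (user_bin M b g u)))"

text \<open>The tail-sum formula for an expectation. The input \<open>g u\<close> always hits the
  final bin of \<open>u\<close>, so the search ends within \<open>2 ^ n\<close> guesses and the sum
  may stop there.\<close>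

lemma key_expectation_eq:
  assumes "u \<in> {1..M}" "g u \<in> {1..2 ^ n}"
  shows "key_expectation g u = (\<Sum>t<2 ^ n. measure_pmf.prob (key_pmf n m p)
    {k. \<forall>i\<in>{1..t}. backdoor_key M b g k (\<sigma> i) \<noteq> user_bin M b g u})"
proof -
  let ?c = "user_bin M b g u"
  let ?E = "\<lambda>t. {k. \<forall>i\<in>{1..t}. backdoor_key M b g k (\<sigma> i) \<noteq> ?c}"
  obtain i where i: "i \<in> {1..2 ^ n}" "\<sigma> i = g u"
    using attack_order assms(2) by (metis bij_betw_imp_surj_on imageE)
  have "real (guesses \<sigma> (backdoor_key M b g k) ?c) = (\<Sum>t<2 ^ n. indicator (?E t) k)" for k
  proof -
    let ?G = "guesses \<sigma> (backdoor_key M b g k) ?c"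
    have hit: "1 \<le> i" "hash (backdoor_key M b g k) (\<sigma> i) = ?c"
      using i assms by (auto simp: hash_def backdoor_key_def user_bin_def)
    have "?G \<le> 2 ^ n"
      using guesses_le[of i _ \<sigma>, OF hit] i by auto
    then have "{..<2 ^ n} \<inter> {t. t < ?G} = {..<?G}" by auto
    moreover have "(\<Sum>t<2 ^ n. indicator (?E t) k) = (\<Sum>t<2 ^ n. if t < ?G then 1 else 0 :: real)"
      using less_guesses_iff[of i _ \<sigma>, OF hit] by (intro sum.cong) (auto simp: hash_def)
    ultimately show ?thesis by (simp add: sum.If_cases)
  qed
  then have "key_expectation g u =
      measure_pmf.expectation (key_pmf n m p) (\<lambda>k. \<Sum>t<2 ^ n. indicator (?E t) k)"
    by simp
  also have "\<dots> = (\<Sum>t<2 ^ n. measure_pmf.prob (key_pmf n m p) (?E t))"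
    by (subst Bochner_Integration.integral_sum)
      (auto intro: integrable_measure_pmf_finite finite_set_key_pmf)
  finally show ?thesis .
qed

lemma attacked_inputs:
  assumes "t \<le> 2 ^ n"
  shows "\<sigma> ` {1..t} \<subseteq> {1..2 ^ n}" "card (\<sigma> ` {1..t}) = t"
proof -
  have "{1..t} \<subseteq> {1..2 ^ n}" using assms by auto
  then show "\<sigma> ` {1..t} \<subseteq> {1..2 ^ n}" "card (\<sigma> ` {1..t}) = t"
    using attack_order by (auto simp: bij_betw_def card_image inj_on_subset)
qed

text \<open>Hits on replaced segments only shorten the search, so they may be ignored. At most
  \<open>M\<close> inputs were drawn, hence at least \<open>t - M\<close> of the first
  \<open>t\<close> guesses meet independent original segments, each a hit with probability
  \<open>?q\<close>.\<close>

lemma key_expectation_le: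
  assumes u: "u \<in> {1..M}" and g: "g u \<in> {1..2 ^ n}"
  shows "key_expectation g u \<le> real M + 1 / \<pi> (first_user g u)"
proof -
  let ?q = "\<pi> (first_user g u)"
  have q: "0 < ?q" "?q \<le> 1"
    using prob_pos first_user[OF u] P_K_le_1 by auto
  have "key_expectation g u \<le> (\<Sum>t<2 ^ n. (1 - ?q) ^ (t - M))"
    unfolding key_expectation_eq[of _ g, OF u g]
  proof (rule sum_mono)
    fix t :: nat assume "t \<in> {..<2 ^ n}"
    then have t: "t \<le> 2 ^ n" by simp
    let ?J = "\<sigma> ` {1..t} - g ` {1..M}"
    have "{k. \<forall>i\<in>{1..t}. backdoor_key M b g k (\<sigma> i) \<noteq> user_bin M b g u}
        \<subseteq> {k. \<forall>j\<in>?J. k j \<noteq> b (first_user g u)}"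
      by (auto simp: backdoor_key_def user_bin_eq)
    then have "measure_pmf.prob (key_pmf n m p)
        {k. \<forall>i\<in>{1..t}. backdoor_key M b g k (\<sigma> i) \<noteq> user_bin M b g u}
      \<le> measure_pmf.prob (key_pmf n m p) {k. \<forall>j\<in>?J. k j \<noteq> b (first_user g u)}"
      by (intro measure_pmf.finite_measure_mono) auto
    also have "\<dots> = (1 - ?q) ^ card ?J"
      using attacked_inputs[OF t] by (intro prob_key_avoids) auto
    also have "\<dots> \<le> (1 - ?q) ^ (t - M)"
    proof (rule power_decreasing)
      have "card (\<sigma> ` {1..t}) - card (g ` {1..M}) \<le> card ?J"
        by (intro diff_card_le_card_Diff) auto
      moreover have "card (g ` {1..M}) \<le> M"
        using card_image_le[of "{1..M}" g] by simp
      ultimately show "t - M \<le> card ?J"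
        using attacked_inputs[OF t] by linarith
    qed (use q in auto)
    finally show "measure_pmf.prob (key_pmf n m p)
        {k. \<forall>i\<in>{1..t}. backdoor_key M b g k (\<sigma> i) \<noteq> user_bin M b g u} \<le> (1 - ?q) ^ (t - M)" .
  qed
  also have "\<dots> \<le> real M + 1 / ?q"
    using q by (rule sum_geometric_delayed_le)
  finally show ?thesis .
qed

text \<open>Until the attacker tries \<open>g u\<close>, no replaced segment is a hit: it belongs to
  another password, hence to another first user, whose bin differs by injectivity. It then suffices
  that the original key avoids the bin on all \<open>t\<close> tried inputs, overwritten ones
  included.\<close>

lemma key_expectation_ge:
  assumes u: "u \<in> {1..M}" and g: "g u \<in> {1..2 ^ n}" and T: "T \<le> 2 ^ n"
  shows "(\<Sum>t<T. indicator {g. g u \<notin> \<sigma> ` {1..t}} g * (1 - \<pi> u) ^ t) \<le> key_expectation g u"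
proof -
  let ?E = "\<lambda>t. {k. \<forall>i\<in>{1..t}. backdoor_key M b g k (\<sigma> i) \<noteq> user_bin M b g u}"
  have "(\<Sum>t<T. indicator {g. g u \<notin> \<sigma> ` {1..t}} g * (1 - \<pi> u) ^ t)
      \<le> (\<Sum>t<T. measure_pmf.prob (key_pmf n m p) (?E t))"
  proof (rule sum_mono)
    fix t assume "t \<in> {..<T}"
    then have t: "t \<le> 2 ^ n" using T by simp
    show "indicator {g. g u \<notin> \<sigma> ` {1..t}} g * (1 - \<pi> u) ^ t
        \<le> measure_pmf.prob (key_pmf n m p) (?E t)"
    proof (cases "g u \<in> \<sigma> ` {1..t}")
      case False
      let ?q = "\<pi> (first_user g u)"
      have "backdoor_key M b g k (\<sigma> i) \<noteq> b (first_user g u)"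
        if i: "i \<in> {1..t}" and k: "\<forall>j\<in>\<sigma> ` {1..t}. k j \<noteq> b (first_user g u)" for i k
      proof (cases "\<sigma> i \<in> g ` {1..M}")
        case True
        then obtain v where v: "v \<in> {1..M}" "\<sigma> i = g v" by auto
        then have "backdoor_key M b g k (\<sigma> i) = b (first_user g v)"
          by (simp add: backdoor_key_def first_user_def)
        moreover have "first_user g v \<noteq> first_user g u"
          using first_user(3)[OF u, of g] first_user(3)[OF v(1), of g] v(2) i False by (metis imageI)
        ultimately show ?thesis
          using inj_on_bins first_user(1)[OF u] first_user(1)[OF v(1)] by (metis inj_onD)
      next
        case drawn: False
        then show ?thesis using i k by (auto simp: backdoor_key_def)
      qed
      then have sub: "{k. \<forall>j\<in>\<sigma> ` {1..t}. k j \<noteq> b (first_user g u)} \<subseteq> ?E t"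
        by (auto simp: user_bin_eq)
      \<comment> \<open>The first user does not come after \<open>u\<close>, so its bin is at most
        as likely; the resulting bound no longer depends on who the first user is.\<close>
      have "(1 - \<pi> u) ^ t \<le> (1 - ?q) ^ t"
        using prob_mono first_user[OF u] u P_K_le_1 by (intro power_mono) auto
      also have "\<dots> = measure_pmf.prob (key_pmf n m p) {k. \<forall>j\<in>\<sigma> ` {1..t}. k j \<noteq> b (first_user g u)}"
        using attacked_inputs[OF t] by (subst prob_key_avoids) auto
      also have "\<dots> \<le> measure_pmf.prob (key_pmf n m p) (?E t)"
        using sub by (intro measure_pmf.finite_measure_mono) auto
      finally show ?thesis using False by simp
    qed simp
  qed
  also have "\<dots> \<le> (\<Sum>t<2 ^ n. measure_pmf.prob (key_pmf n m p) (?E t))"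
    using T by (intro sum_mono2) auto
  also have "\<dots> = key_expectation g u"
    using key_expectation_eq[of u g, OF u g] by simp
  finally show ?thesis .
qed

section \<open>Averaging over the passwords\<close>

abbreviation guesswork :: "nat \<Rightarrow> real" where
  "guesswork u \<equiv> measure_pmf.expectation (password_pmf n M) (\<lambda>g. key_expectation g u)"

lemma avg_guesswork_remote_eq:
  "avg_guesswork_remote n m p M b \<sigma> = (\<Sum>u = 1..M. guesswork u) / real M"
  unfolding avg_guesswork_remote_def
  by (subst expectation_pair_pmf[OF finite_set_key_pmf finite_set_password_pmf]) simp

lemma integrable_password [simp, intro]:
  "integrable (measure_pmf (password_pmf n M)) (f :: _ \<Rightarrow> real)"
  by (rule integrable_measure_pmf_finite[OF finite_set_password_pmf])

text \<open>The bin of \<open>u\<close> changes only if some other user \<open>v\<close> drew the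
  same password. Summing over all candidates \<open>v\<close>, each with collision probability at
  most \<open>1 / 2 ^ n \<le> 1 / M\<close>, costs one further
  \<open>mean_inverse_prob\<close>.\<close>

lemma guesswork_le:
  assumes u: "u \<in> {1..M}"
  shows "guesswork u \<le> real M + 1 / \<pi> u + mean_inverse_prob"
proof -
  let ?U = "{1..M} - {u}"
  have "guesswork u \<le> measure_pmf.expectation (password_pmf n M)
    (\<lambda>g. real M + 1 / \<pi> u + (\<Sum>v\<in>?U. indicator {g. g v = g u} g * (1 / \<pi> v)))"
  proof (intro integral_mono_AE AE_pmfI integrable_password)
    fix g assume "g \<in> set_pmf (password_pmf n M)"
    then have "key_expectation g u \<le> real M + 1 / \<pi> (first_user g u)"
      using password_in_range u by (intro key_expectation_le) auto
    also have "1 / \<pi> (first_user g u) \<le> 1 / \<pi> u + (\<Sum>v\<in>?U. indicator {g. g v = g u} g * (1 / \<pi> v))"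
    proof (cases "first_user g u = u")
      case False
      have "1 / \<pi> (first_user g u)
          = indicator {g. g (first_user g u) = g u} g * (1 / \<pi> (first_user g u))"
        using first_user[OF u] by simp
      also have "\<dots> \<le> (\<Sum>v\<in>?U. indicator {g. g v = g u} g * (1 / \<pi> v))"
        using member_le_sum[of "first_user g u" ?U "\<lambda>v. indicator {g. g v = g u} g * (1 / \<pi> v)"]
          False first_user[OF u] prob_pos by (auto simp: less_imp_le)
      finally show ?thesis using prob_pos[OF u] by (simp add: add_increasing)
    qed (use prob_pos in \<open>auto intro!: sum_nonneg simp: less_imp_le\<close>)
    finally show "key_expectation g u
        \<le> real M + 1 / \<pi> u + (\<Sum>v\<in>?U. indicator {g. g v = g u} g * (1 / \<pi> v))"
      by simp
  qed
  also have "\<dots> = real M + 1 / \<pi> u +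
      (\<Sum>v\<in>?U. measure_pmf.prob (password_pmf n M) {g. g v = g u} * (1 / \<pi> v))"
    by (simp add: Bochner_Integration.integral_sum)
  also have "(\<Sum>v\<in>?U. measure_pmf.prob (password_pmf n M) {g. g v = g u} * (1 / \<pi> v))
      \<le> (\<Sum>v\<in>?U. 1 / 2 ^ n * (1 / \<pi> v))"
    using prob_password_collision[OF u] prob_pos
    by (intro sum_mono mult_right_mono) (auto simp: less_imp_le)
  also have "\<dots> \<le> (\<Sum>v\<in>{1..M}. 1 / real M * (1 / \<pi> v))"
  proof (rule order.trans[OF sum_mono sum_mono2])
    fix v assume v: "v \<in> ?U"
    have "real M \<le> 2 ^ n" using M_le_num_inputs by (metis of_nat_le_iff of_nat_numeral of_nat_power)
    then have "1 / 2 ^ n \<le> 1 / real M" using M_pos by (intro divide_left_mono) auto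
    then show "1 / 2 ^ n * (1 / \<pi> v) \<le> 1 / real M * (1 / \<pi> v)"
      using prob_pos[of v] v by (intro mult_right_mono) auto
  qed (use prob_pos in \<open>auto simp: less_imp_le\<close>)
  also have "\<dots> = mean_inverse_prob"
    by (simp add: mean_inverse_prob_def sum_divide_distrib mult.commute)
  finally show ?thesis by simp
qed

text \<open>For \<open>t\<close> below \<open>1 / (2 * \<pi> u)\<close>, the password of
  \<open>u\<close> is still untried with probability at least one half, and by Bernoulli's
  inequality \<open>(1 - \<pi> u) ^ t\<close> is at least one half. The first \<open>T\<close> terms
  of the tail sum thus contribute a quarter each.\<close>

lemma guesswork_ge:
  assumes u: "u \<in> {1..M}"
  shows "1 / (8 * \<pi> u) \<le> guesswork u"
proof -
  define T where "T = nat \<lceil>1 / (2 * \<pi> u)\<rceil>"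
  have pos: "0 < \<pi> u" and le1: "\<pi> u \<le> 1" using prob_pos[OF u] P_K_le_1 by auto
  have T_ge: "1 / (2 * \<pi> u) \<le> real T"
    unfolding T_def by linarith
  have "1 / (2 * \<pi> u) \<le> 2 ^ n"
    using inverse_prob_le[OF u] pos by (simp add: field_simps)
  then have "\<lceil>1 / (2 * \<pi> u)\<rceil> \<le> 2 ^ n"
    by (subst ceiling_le_iff) simp
  then have T_le: "T \<le> 2 ^ n"
    by (simp add: T_def nat_le_iff)
  have small: "real t * \<pi> u \<le> 1 / 2" if "t < T" for t
  proof -
    have "real t < 1 / (2 * \<pi> u)" using that unfolding T_def by linarith
    then show ?thesis using pos by (simp add: field_simps)
  qed
  have summand: "1 / 4 \<le> measure_pmf.prob (password_pmf n M) {g. g u \<notin> \<sigma> ` {1..t}} * (1 - \<pi> u) ^ t"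
    if "t < T" for t
  proof -
    have t: "t \<le> 2 ^ n" using that T_le by simp
    have "1 / 2 \<le> 1 + real t * (- \<pi> u)" using small[OF that] by simp
    also have "\<dots> \<le> (1 + - \<pi> u) ^ t"
      using le1 by (intro Bernoulli_inequality) auto
    finally have 1: "1 / 2 \<le> (1 - \<pi> u) ^ t" by simp
    \<comment> \<open>\<open>key_long\<close> enters through \<open>inverse_prob_le\<close>: so few
      guesses cover at most half of the possible passwords.\<close>
    have "real t / 2 ^ n \<le> real t * \<pi> u"
      using mult_left_mono[of 1 "\<pi> u * 2 ^ n" "real t"] inverse_prob_le[OF u] pos
      by (simp add: field_simps)
    also note small[OF that]
    finally have 2: "real t / 2 ^ n \<le> 1 / 2" .
    have "measure_pmf.prob (password_pmf n M) {g. g u \<notin> \<sigma> ` {1..t}}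
        = 1 - measure_pmf.prob (password_pmf n M) {g. g u \<in> \<sigma> ` {1..t}}"
      using measure_pmf.prob_compl[of "{g. g u \<in> \<sigma> ` {1..t}}" "password_pmf n M"]
      by (simp add: Compl_eq_Diff_UNIV[symmetric] Collect_neg_eq)
    also have "\<dots> = 1 - real t / 2 ^ n"
      using prob_password_in[OF u] attacked_inputs[OF t] by simp
    finally show ?thesis
      using mult_mono[of "1 / 2" "1 - real t / 2 ^ n" "1 / 2" "(1 - \<pi> u) ^ t"] 1 2 t by simp
  qed
  have "1 / (8 * \<pi> u) = 1 / (2 * \<pi> u) / 4" by simp
  also have "\<dots> \<le> real T / 4" using T_ge by (intro divide_right_mono) auto
  also have "\<dots> = (\<Sum>t<T. 1 / 4)" by simp
  also have "\<dots> \<le> (\<Sum>t<T. measure_pmf.prob (password_pmf n M) {g. g u \<notin> \<sigma> ` {1..t}} * (1 - \<pi> u) ^ t)"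
    using summand by (intro sum_mono) auto
  also have "\<dots> = measure_pmf.expectation (password_pmf n M)
      (\<lambda>g. \<Sum>t<T. indicator {g. g u \<notin> \<sigma> ` {1..t}} g * (1 - \<pi> u) ^ t)"
    by (subst Bochner_Integration.integral_sum) auto
  also have "\<dots> \<le> guesswork u"
    using key_expectation_ge[OF u _ T_le] password_in_range u
    by (intro integral_mono_AE AE_pmfI integrable_password) blast
  finally show ?thesis .
qed

text \<open>Averaging \<open>guesswork_le\<close> gives \<open>M\<close> plus twice
  \<open>mean_inverse_prob\<close>, and \<open>M_le_mean_inverse_prob\<close> absorbs the
  \<open>M\<close>.\<close>

lemma avg_guesswork_le: "avg_guesswork_remote n m p M b \<sigma> \<le> 3 * mean_inverse_prob"
proof -
  have "(\<Sum>u = 1..M. guesswork u) \<le> (\<Sum>u = 1..M. real M + 1 / \<pi> u + mean_inverse_prob)"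
    by (intro sum_mono guesswork_le)
  also have "\<dots> = real M * (real M + 2 * mean_inverse_prob)"
    using M_pos by (simp add: sum.distrib mean_inverse_prob_def algebra_simps)
  also have "\<dots> \<le> real M * (3 * mean_inverse_prob)"
    using M_le_mean_inverse_prob by (intro mult_left_mono) auto
  finally show ?thesis
    using M_pos by (simp add: avg_guesswork_remote_eq field_simps)
qed

lemma avg_guesswork_ge: "mean_inverse_prob / 8 \<le> avg_guesswork_remote n m p M b \<sigma>"
proof -
  have "(\<Sum>u = 1..M. 1 / \<pi> u) / 8 = (\<Sum>u = 1..M. 1 / (8 * \<pi> u))"
    by (simp add: sum_divide_distrib mult.commute)
  also have "\<dots> \<le> (\<Sum>u = 1..M. guesswork u)"
    by (intro sum_mono guesswork_ge)
  finally show ?thesis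
    unfolding avg_guesswork_remote_eq mean_inverse_prob_def
    using M_pos by (simp add: field_simps)
qed

end

subsection \<open>Exponents\<close>

text \<open>The exponent per bit of \<open>1 / P_K m p x\<close> for a bin with a fraction
  \<open>q\<close> of ones. Being affine in \<open>q\<close>, it makes the comparisons of exponents
  linear.\<close>

definition cross_entropy :: "real \<Rightarrow> real \<Rightarrow> real" where
  "cross_entropy q p = - q * log 2 p - (1 - q) * log 2 (1 - p)"

lemma entropy_eq_cross_entropy: "bin_entropy q = cross_entropy q q"
  by (simp add: bin_entropy_def cross_entropy_def)

lemma cross_entropy_eq:
  assumes "0 \<le> q" "q \<le> 1" "0 < p" "p < 1"
  shows "cross_entropy q p = bin_entropy q + bin_divergence q p"
proof -
  have "q * log 2 (q / p) = q * log 2 q - q * log 2 p"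
    using assms by (cases "q = 0") (auto simp: log_divide algebra_simps)
  moreover have "(1 - q) * log 2 ((1 - q) / (1 - p)) = (1 - q) * log 2 (1 - q) - (1 - q) * log 2 (1 - p)"
    using assms by (cases "q = 1") (auto simp: log_divide algebra_simps)
  ultimately show ?thesis
    by (simp add: cross_entropy_def bin_entropy_def bin_divergence_def)
qed

text \<open>Gibbs' inequality from \<open>ln x \<le> x - 1\<close>: the linear lower bounds of the
  two summands cancel because both distributions have mass one.\<close>

lemma bin_divergence_nonneg:
  assumes "0 \<le> q" "q \<le> 1" "0 < p" "p < 1"
  shows "0 \<le> bin_divergence q p"
proof -
  have gibbs: "(x - y) / ln 2 \<le> x * log 2 (x / y)" if "0 \<le> x" "0 < y" for x y :: real
  proof (cases "x = 0")
    case False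
    then have x: "0 < x" using that by simp
    have "ln (y / x) \<le> y / x - 1"
      using x that by (intro ln_le_minus_one) auto
    then have "x - y \<le> x * ln (x / y)"
      using x that by (simp add: ln_div field_simps)
    then show ?thesis
      by (simp add: log_def divide_right_mono)
  qed (use that in simp)
  have "0 = (q - p) / ln 2 + ((1 - q) - (1 - p)) / ln 2"
    by (simp flip: add_divide_distrib)
  also have "\<dots> \<le> bin_divergence q p"
    unfolding bin_divergence_def using assms by (intro add_mono gibbs) auto
  finally show ?thesis .
qed

lemma cross_entropy_diff:
  "cross_entropy r p - cross_entropy q p = (r - q) * (log 2 (1 - p) - log 2 p)"
  by (simp add: cross_entropy_def algebra_simps)

text \<open>As a function of \<open>t\<close>, \<open>cross_entropy t s\<close> is the tangent to
  the entropy at \<open>s\<close>. It lies above the entropy by Gibbs and has nonpositive slope for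
  \<open>s \<ge> 1 / 2\<close>. At \<open>s = 1\<close> there is no such tangent, whence the case
  split.\<close>

lemma bin_entropy_antimono:
  assumes "1 / 2 \<le> s" "s \<le> t" "t \<le> 1"
  shows "bin_entropy t \<le> bin_entropy s"
proof (cases "s = 1")
  case False
  then have s: "0 < s" "s < 1" using assms by auto
  have "bin_entropy t \<le> cross_entropy t s"
    using cross_entropy_eq[of t s] bin_divergence_nonneg[of t s] assms s by simp
  also have "cross_entropy t s - cross_entropy s s \<le> 0"
    unfolding cross_entropy_diff using assms s by (intro mult_nonneg_nonpos) auto
  then have "cross_entropy t s \<le> cross_entropy s s" by simp
  finally show ?thesis by (simp add: entropy_eq_cross_entropy)
qed (use assms in simp)

lemma bin_entropy_bounds:
  assumes "1 / 2 \<le> s" "s \<le> 1"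
  shows "0 \<le> bin_entropy s" "bin_entropy s \<le> 1"
proof -
  show "0 \<le> bin_entropy s"
    using bin_entropy_antimono[of s 1] assms by (simp add: bin_entropy_def)
  have "bin_entropy (1 / 2) = 1"
    using log_divide[of 2 1 2] by (simp add: bin_entropy_def)
  then show "bin_entropy s \<le> 1"
    using bin_entropy_antimono[of "1 / 2" s] assms by simp
qed

lemma bin_entropy_symmetric: "bin_entropy (1 - q) = bin_entropy q"
  by (simp add: bin_entropy_def algebra_simps)

section \<open>Sums of inverse bin probabilities\<close>

lemma ones_le: "x \<in> bins m \<Longrightarrow> ones x \<le> m"
  using ones_le_length[of x] by (simp add: bins_def)

lemma P_K_powr:
  assumes "0 < q" "q < 1" "x \<in> bins m" "1 \<le> m"
  shows "P_K m q x = 2 powr (- (real m * cross_entropy (real (ones x) / real m) q))"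
proof -
  have power: "(2 powr y) ^ k = 2 powr (real k * y)" for y :: real and k
    by (simp add: powr_powr mult.commute flip: powr_realpow)
  have "q = 2 powr log 2 q" "1 - q = 2 powr log 2 (1 - q)" using assms by auto
  then have "P_K m q x = (2 powr log 2 q) ^ ones x * (2 powr log 2 (1 - q)) ^ (m - ones x)"
    using P_K_eq[of q x m] assms by simp
  also have "\<dots> = 2 powr (real (ones x) * log 2 q + real (m - ones x) * log 2 (1 - q))"
    by (simp only: power powr_add)
  also have "real (ones x) * log 2 q + real (m - ones x) * log 2 (1 - q) =
      - (real m * cross_entropy (real (ones x) / real m) q)"
    using assms ones_le[OF assms(3)] by (simp add: cross_entropy_def of_nat_diff field_simps)
  finally show ?thesis .
qed

lemma inverse_P_K:
  assumes "0 < q" "q < 1" "x \<in> bins m" "1 \<le> m"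
  shows "1 / P_K m q x = 2 powr (real m * cross_entropy (real (ones x) / real m) q)"
  using P_K_powr[OF assms] by (simp add: powr_minus divide_inverse)

lemma cross_entropy_mono:
  assumes "0 < p" "p \<le> 1 / 2" "q \<le> r"
  shows "cross_entropy q p \<le> cross_entropy r p"
proof -
  have "0 \<le> cross_entropy r p - cross_entropy q p"
    unfolding cross_entropy_diff using assms by (intro mult_nonneg_nonneg) auto
  then show ?thesis by simp
qed

text \<open>
  Changing the measure to Bernoulli(\<open>t\<close>): the left-hand side times \<open>P_K m t x\<close> is an
  exponential in \<open>ones x\<close>, decreasing if \<open>t > 1 - p\<close> and constant if \<open>t = 1 - p\<close>.
\<close>

lemma inverse_P_K_le_tilted:
  assumes p: "0 < p" "p < 1" and t: "0 < t" "t < 1" and x: "x \<in> bins m" and m: "1 \<le> m"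
    and "t = 1 - p \<or> 1 - p \<le> t \<and> t * real m \<le> real (ones x)"
  shows "1 / P_K m p x \<le> P_K m t x * 2 powr (real m * (bin_entropy t + cross_entropy t p))"
proof -
  define q where "q = real (ones x) / real m"
  \<comment> \<open>The threshold \<open>1 - p\<close> arises from
    \<open>(1 - t) * (1 - p) - t * p = 1 - p - t\<close>.\<close>
  have slope: "log 2 (1 - t) + log 2 (1 - p) \<le> log 2 t + log 2 p" if "1 - p \<le> t"
  proof -
    have "0 < (1 - t) * (1 - p)" "(1 - t) * (1 - p) \<le> t * p"
      using that p t by (simp, simp add: algebra_simps)
    then have "log 2 ((1 - t) * (1 - p)) \<le> log 2 (t * p)"
      using p t by simp
    then show ?thesis using p t by (simp add: log_mult)
  qed
  have "(cross_entropy q p - cross_entropy t p) + (cross_entropy q t - cross_entropy t t)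
      = (q - t) * ((log 2 (1 - t) + log 2 (1 - p)) - (log 2 t + log 2 p))"
    unfolding cross_entropy_diff by (simp add: algebra_simps)
  also have "\<dots> \<le> 0"
    using assms(7)
  proof
    assume "1 - p \<le> t \<and> t * real m \<le> real (ones x)"
    then have "t \<le> q" "1 - p \<le> t"
      using m by (auto simp: q_def field_simps)
    with slope show ?thesis by (intro mult_nonneg_nonpos) auto
  qed auto
  finally have "cross_entropy q p \<le> bin_entropy t + cross_entropy t p - cross_entropy q t"
    by (simp add: entropy_eq_cross_entropy)
  then have "real m * cross_entropy q p
      \<le> - (real m * cross_entropy q t) + real m * (bin_entropy t + cross_entropy t p)"
    using mult_left_mono[of "cross_entropy q p" "bin_entropy t + cross_entropy t p - cross_entropy q t" "real m"]
    by (simp add: algebra_simps)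
  then show ?thesis
    unfolding inverse_P_K[OF p x m] P_K_powr[OF t x m] q_def[symmetric] powr_add[symmetric]
    by simp
qed

text \<open>Bins with at least \<open>t * m\<close> ones, and all bins if \<open>t = 1 - p\<close>,
  are handled by the change of measure, as the tilted probabilities sum to at most one. For
  \<open>t = s\<close> the remaining bins are counted, each with the inverse probability at the
  boundary fraction \<open>t\<close>. The factor 2 adds both parts.\<close>

lemma sum_inverse_P_K_le:
  assumes p: "0 < p" "p \<le> 1 / 2" and s: "1 / 2 \<le> s" "s \<le> 1" and m: "1 \<le> m"
    and A: "A \<subseteq> bins m" "real (card A) \<le> 2 powr (bin_entropy s * real m)"
    and t: "t = max s (1 - p)"
  shows "(\<Sum>x\<in>A. 1 / P_K m p x) \<le> 2 * 2 powr (real m * (bin_entropy t + cross_entropy t p))"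
proof -
  let ?B = "2 powr (real m * (bin_entropy t + cross_entropy t p))"
  have fin: "finite A" using A finite_bins finite_subset by blast
  have tilted: "(\<Sum>x\<in>C. 1 / P_K m p x) \<le> ?B"
    if "C \<subseteq> A" "t < 1" "t = 1 - p \<or> (\<forall>x\<in>C. t * real m \<le> real (ones x))" for C
  proof -
    have "(\<Sum>x\<in>C. 1 / P_K m p x) \<le> (\<Sum>x\<in>C. P_K m t x * ?B)"
    proof (rule sum_mono)
      fix x assume "x \<in> C"
      then show "1 / P_K m p x \<le> P_K m t x * ?B"
        using that A p s t m by (intro inverse_P_K_le_tilted) auto
    qed
    also have "\<dots> = (\<Sum>x\<in>C. P_K m t x) * ?B"
      by (simp add: sum_distrib_right)
    also have "\<dots> \<le> 1 * ?B"
      using that fin by (intro mult_right_mono sum_P_K_le_1) (auto intro: finite_subset)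
    finally show ?thesis by simp
  qed
  have bounded: "(\<Sum>x\<in>C. 1 / P_K m p x) \<le> ?B"
    if "C \<subseteq> A" "t = s" "\<And>x. x \<in> C \<Longrightarrow> real (ones x) \<le> t * real m" for C
  proof -
    have "1 / P_K m p x \<le> 2 powr (real m * cross_entropy t p)" if x: "x \<in> C" for x
    proof -
      have "real (ones x) / real m \<le> t"
        using that(1) \<open>\<And>x. x \<in> C \<Longrightarrow> real (ones x) \<le> t * real m\<close>[OF x] m by (simp add: field_simps)
      then have "cross_entropy (real (ones x) / real m) p \<le> cross_entropy t p"
        using p by (intro cross_entropy_mono)
      moreover have "x \<in> bins m" using x \<open>C \<subseteq> A\<close> A by blast
      ultimately show ?thesis
        using p m by (subst inverse_P_K) (auto intro: mult_left_mono)
    qed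
    then have "(\<Sum>x\<in>C. 1 / P_K m p x) \<le> real (card C) * 2 powr (real m * cross_entropy t p)"
      using sum_bounded_above[of C "\<lambda>x. 1 / P_K m p x"] by simp
    also have "\<dots> \<le> 2 powr (bin_entropy s * real m) * 2 powr (real m * cross_entropy t p)"
    proof (rule mult_right_mono)
      have "card C \<le> card A" using that fin by (intro card_mono)
      then show "real (card C) \<le> 2 powr (bin_entropy s * real m)" using A by linarith
    qed simp
    also have "\<dots> = ?B"
      using \<open>t = s\<close> by (simp add: algebra_simps flip: powr_add)
    finally show ?thesis .
  qed
  consider "t = 1 - p" "t < 1" | "t = s" "t < 1" | "t = s" "t = 1"
    using t p s by linarith
  then show ?thesis
  proof cases
    case 1
    then have "(\<Sum>x\<in>A. 1 / P_K m p x) \<le> ?B" by (intro tilted) auto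
    then show ?thesis by (smt (verit) powr_ge_zero)
  next
    case 2
    let ?C = "{x \<in> A. t * real m \<le> real (ones x)}"
    have "(\<Sum>x\<in>A. 1 / P_K m p x) = (\<Sum>x\<in>?C. 1 / P_K m p x) + (\<Sum>x\<in>A - ?C. 1 / P_K m p x)"
      using fin by (subst sum.subset_diff[of ?C A]) auto
    also have "\<dots> \<le> ?B + ?B"
      using 2 by (intro add_mono tilted bounded) auto
    finally show ?thesis by simp
  next
    \<comment> \<open>Tilting to Bernoulli(1) would be degenerate, but no bin has more than
      \<open>m\<close> ones, so counting covers all of \<open>A\<close>.\<close>
    case 3
    then have "(\<Sum>x\<in>A. 1 / P_K m p x) \<le> ?B"
      using A ones_le by (intro bounded) auto
    then show ?thesis by (smt (verit) powr_ge_zero)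
  qed
qed

text \<open>Either every allocated bin is at most as likely as a bin with \<open>w\<close> ones, or
  some allocated bin is strictly likelier, and then the ordering places all bins with
  \<open>w\<close> ones before it, so that all of them are allocated.\<close>

lemma (in remote_attack) sum_inverse_prob_ge:
  assumes w: "w \<le> m" "1 \<le> m"
  shows "real (min M (m choose w)) * 2 powr (real m * cross_entropy (real w / real m) p)
    \<le> (\<Sum>u = 1..M. 1 / \<pi> u)"
proof -
  let ?v = "2 powr (real m * cross_entropy (real w / real m) p)"
  define B where "B = {x \<in> bins m. ones x = w}"
  have v: "1 / P_K m p x = ?v" if "x \<in> B" for x
    using that p_pos p_le w by (subst inverse_P_K) (auto simp: B_def)
  show ?thesis
  proof (cases "\<forall>u\<in>{1..M}. ?v \<le> 1 / \<pi> u")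
    case True
    have "real (min M (m choose w)) * ?v \<le> real M * ?v"
      by (intro mult_right_mono) auto
    also have "\<dots> = (\<Sum>u = 1..M. ?v)" by simp
    also have "\<dots> \<le> (\<Sum>u = 1..M. 1 / \<pi> u)"
      using True by (intro sum_mono) auto
    finally show ?thesis .
  next
    case False
    then obtain u where u: "u \<in> {1..M}" "1 / \<pi> u < ?v" by auto
    have sub: "B \<subseteq> b ` {1..M}"
    proof
      fix x assume x: "x \<in> B"
      then have "x \<in> b ` {1..2 ^ m}"
        using ordering by (auto simp: bin_ordering_def bij_betw_def B_def)
      then obtain i where i: "i \<in> {1..2 ^ m}" "b i = x" by blast
      have "i \<le> u"
      proof (rule ccontr)
        assume "\<not> i \<le> u"
        then have "\<pi> u \<le> \<pi> i"
          using ordering i u M_le unfolding bin_ordering_def by (auto simp: monotone_on_def)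
        then have "1 / \<pi> i \<le> 1 / \<pi> u"
          using prob_pos[OF u(1)] by (intro divide_left_mono) auto
        with u(2) v[OF x] i(2) show False by simp
      qed
      then show "x \<in> b ` {1..M}" using i u by auto
    qed
    have "real (min M (m choose w)) * ?v \<le> real (m choose w) * ?v"
      by (intro mult_right_mono) auto
    also have "\<dots> = (\<Sum>x\<in>B. 1 / P_K m p x)"
      using v by (simp add: B_def card_bins_ones)
    also have "\<dots> \<le> (\<Sum>x\<in>b ` {1..M}. 1 / P_K m p x)"
      using sub by (intro sum_mono2) (auto simp: P_K_def)
    also have "\<dots> = (\<Sum>u = 1..M. 1 / \<pi> u)"
      using inj_on_bins by (simp add: sum.reindex)
    finally show ?thesis .
  qed
qed

section \<open>Binomial coefficients and entropy\<close>

text \<open>A weak form of Stirling, exact up to a factor \<open>n\<close>. The induction step is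
  \<open>n * (ln (n + 1) - ln n) \<le> 1 \<le> (n + 1) * (ln (n + 1) - ln n)\<close>.\<close>

lemma ln_fact_bounds:
  assumes "1 \<le> n"
  shows "real n * ln (real n) - real n + 1 \<le> ln (fact n)"
    and "ln (fact n) \<le> (real n + 1) * ln (real n) - real n + 1"
proof -
  have "real n * ln (real n) - real n + 1 \<le> ln (fact n) \<and>
    ln (fact n) \<le> (real n + 1) * ln (real n) - real n + 1"
    using assms
  proof (induction n rule: nat_induct_at_least)
    case (Suc n)
    let ?x = "real n"
    have x: "?x > 0" using Suc by simp
    have "ln ((?x + 1) / ?x) \<le> (?x + 1) / ?x - 1"
      using x by (intro ln_le_minus_one) auto
    then have up: "?x * (ln (?x + 1) - ln ?x) \<le> 1"
      using x by (simp add: ln_div field_simps)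
    have "ln (?x / (?x + 1)) \<le> ?x / (?x + 1) - 1"
      using x by (intro ln_le_minus_one) auto
    then have low: "1 \<le> (?x + 1) * (ln (?x + 1) - ln ?x)"
      using x by (simp add: ln_div field_simps)
    have "ln (fact (Suc n) :: real) = ln (?x + 1) + ln (fact n)"
      using x by (simp add: ln_mult add.commute)
    with Suc.IH up low show ?case
      by (simp add: algebra_simps)
  qed simp
  then show "real n * ln (real n) - real n + 1 \<le> ln (fact n)"
    and "ln (fact n) \<le> (real n + 1) * ln (real n) - real n + 1" by auto
qed

text \<open>The main terms of the factorial bounds combine to the entropy; the error
  \<open>ln w + ln (m - w) + 1\<close> is only logarithmic in \<open>m\<close>.\<close>

lemma choose_ge_entropy:
  assumes "1 \<le> w" "w < m"
  shows "2 powr (real m * bin_entropy (real w / real m) - 2 * log 2 (real m) - 2) \<le> real (m choose w)"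
proof -
  define v where "v = m - w"
  have v: "1 \<le> v" "real m = real w + real v" using assms by (auto simp: v_def)
  have "ln (real (m choose w)) = ln (fact m) - ln (fact w) - ln (fact v)"
    using assms by (simp add: binomial_fact v_def ln_div ln_mult)
  also have "\<dots> \<ge> (real m * ln (real m) - real m + 1) - ((real w + 1) * ln (real w) - real w + 1)
      - ((real v + 1) * ln (real v) - real v + 1)"
    using ln_fact_bounds(1)[of m] ln_fact_bounds(2)[OF assms(1)] ln_fact_bounds(2)[OF v(1)] assms
    by simp
  finally have "real m * ln (real m) - real w * ln (real w) - real v * ln (real v)
      - ln (real w) - ln (real v) - 1 \<le> ln (real (m choose w))"
    using v by (simp add: algebra_simps)
  moreover have "ln (real w) \<le> ln (real m)" "ln (real v) \<le> ln (real m)"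
    using assms v by auto
  moreover have "real m * (bin_entropy (real w / real m) * ln 2) =
      real m * ln (real m) - real w * ln (real w) - real v * ln (real v)"
  proof -
    have ln: "log 2 x * ln 2 = ln x" for x :: real
      by (simp add: log_def)
    have compl: "1 - real w / real m = real v / real m"
      using assms v by (simp add: field_simps)
    have "bin_entropy (real w / real m) * ln 2 =
        - (real w / real m) * ln (real w / real m) - real v / real m * ln (real v / real m)"
      by (simp only: bin_entropy_def compl left_diff_distrib mult.assoc ln)
    then have "real m * (bin_entropy (real w / real m) * ln 2) =
        real m * (- (real w / real m) * ln (real w / real m) - real v / real m * ln (real v / real m))"
      by simp
    also have "\<dots> = - real w * ln (real w / real m) - real v * ln (real v / real m)"
      using assms by (simp add: right_diff_distrib)
    also have "\<dots> = (real w + real v) * ln (real m) - real w * ln (real w) - real v * ln (real v)"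
      using assms v(1) by (simp add: ln_div algebra_simps)
    finally show ?thesis using v(2) by simp
  qed
  \<comment> \<open>Converts the additive error 1, in nats, into the 2 bits of the
    statement.\<close>
  moreover have "1 \<le> 2 * ln (2 :: real)"
    using ln2_ge_two_thirds by simp
  ultimately have "(real m * bin_entropy (real w / real m) - 2 * log 2 (real m) - 2) * ln 2
      \<le> ln (real (m choose w))"
    by (simp add: log_def algebra_simps)
  moreover have "0 < real (m choose w)" using assms by simp
  ultimately show ?thesis
    by (simp add: powr_def ln_ge_iff)
qed

lemma ceiling_frequency_tendsto:
  fixes t :: real
  assumes "0 \<le> t"
  shows "(\<lambda>m. real (nat \<lceil>t * real m\<rceil>) / real m) \<longlonglongrightarrow> t"
proof (rule tendsto_sandwich[where f = "\<lambda>_. t" and h = "\<lambda>m. t + 1 / real m"])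
  have *: "t * real m \<le> real (nat \<lceil>t * real m\<rceil>)" "real (nat \<lceil>t * real m\<rceil>) \<le> t * real m + 1" for m :: nat
    using assms by (auto simp: of_nat_nat ceiling_correct intro: less_imp_le)
  show "\<forall>\<^sub>F m in sequentially. t \<le> real (nat \<lceil>t * real m\<rceil>) / real m"
    using eventually_gt_at_top[of 0] by eventually_elim (use *(1) in \<open>simp add: field_simps\<close>)
  show "\<forall>\<^sub>F m in sequentially. real (nat \<lceil>t * real m\<rceil>) / real m \<le> t + 1 / real m"
    using eventually_gt_at_top[of 0] by eventually_elim (use *(2) in \<open>simp add: field_simps\<close>)
  show "(\<lambda>m. t + 1 / real m) \<longlonglongrightarrow> t"
    by real_asymp
qed simp

text \<open>The existential \<open>h\<close> also covers \<open>t = 1\<close>, where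
  \<open>w = m\<close> is outside the scope of \<open>choose_ge_entropy\<close> and the exponent is
  0.\<close>

lemma choose_exponent:
  assumes "0 < t" "t \<le> 1"
  shows "\<exists>h. h \<longlonglongrightarrow> bin_entropy t \<and>
    (\<forall>\<^sub>F m in sequentially. 2 powr (real m * h m) \<le> real (m choose nat \<lceil>t * real m\<rceil>))"
proof (cases "t = 1")
  case True
  then show ?thesis
    by (intro exI[of _ "\<lambda>_. 0"]) (simp add: bin_entropy_def)
next
  case False
  then have t: "0 < t" "t < 1" using assms by auto
  define w where "w = (\<lambda>m. nat \<lceil>t * real m\<rceil>)"
  define h where "h = (\<lambda>m. bin_entropy (real (w m) / real m) - 2 * log 2 (real m) / real m - 2 / real m)"
  have freq: "(\<lambda>m. real (w m) / real m) \<longlonglongrightarrow> t"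
    unfolding w_def using t by (intro ceiling_frequency_tendsto) auto
  have "(\<lambda>m. bin_entropy (real (w m) / real m)) \<longlonglongrightarrow> bin_entropy t"
    unfolding bin_entropy_def using t by (intro tendsto_intros freq) auto
  moreover have "(\<lambda>m. 2 * log 2 (real m) / real m) \<longlonglongrightarrow> 0" "(\<lambda>m. 2 / real m) \<longlonglongrightarrow> 0"
    by real_asymp+
  ultimately have "h \<longlonglongrightarrow> bin_entropy t - 0 - 0"
    unfolding h_def by (intro tendsto_diff)
  moreover have "\<forall>\<^sub>F m in sequentially. 2 powr (real m * h m) \<le> real (m choose w m)"
    using order_tendstoD(1)[OF freq t(1)] order_tendstoD(2)[OF freq t(2)] eventually_gt_at_top[of 0]
  proof eventually_elim
    case (elim m)
    then have "1 \<le> w m" "w m < m" by (auto simp: field_simps Suc_le_eq zero_less_divide_iff)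
    from choose_ge_entropy[OF this] show ?case
      using elim by (simp add: h_def algebra_simps)
  qed
  ultimately show ?thesis unfolding w_def by auto
qed

section \<open>Number of users and the limit\<close>

lemma num_users_bounds:
  assumes "1 / 2 \<le> s" "s \<le> 1"
  shows "1 \<le> num_users s m"
    and "2 powr (bin_entropy s * real m - 2) \<le> real (num_users s m)"
    and "real (num_users s m) \<le> 2 powr (bin_entropy s * real m)"
proof -
  let ?x = "2 powr (bin_entropy s * real m - 1)"
  show one: "1 \<le> num_users s m" by (simp add: num_users_def)
  \<comment> \<open>Rounding down at most halves a number that is at least 1, and otherwise the
    maximum with 1 takes over. This costs the second bit in the exponent.\<close>
  have "?x / 2 \<le> max 1 (real_of_int \<lfloor>?x\<rfloor>)"
    by (cases "?x \<ge> 1") linarith+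
  also have "\<dots> = real (num_users s m)"
    by (simp add: num_users_def)
  finally have "?x / 2 \<le> real (num_users s m)" .
  then show "2 powr (bin_entropy s * real m - 2) \<le> real (num_users s m)"
    using powr_diff[of 2 "bin_entropy s * real m - 1" 1] by (simp add: algebra_simps)
  have "real (num_users s m) = max 1 (real_of_int \<lfloor>?x\<rfloor>)"
    by (simp add: num_users_def)
  also have "\<dots> \<le> 2 powr (bin_entropy s * real m)"
  proof (rule max.boundedI)
    show "1 \<le> 2 powr (bin_entropy s * real m)"
      using bin_entropy_bounds[OF assms] by (intro ge_one_powr_ge_zero) auto
    have "real_of_int \<lfloor>?x\<rfloor> \<le> ?x" by simp
    also have "\<dots> \<le> 2 powr (bin_entropy s * real m)" by simp
    finally show "real_of_int \<lfloor>?x\<rfloor> \<le> 2 powr (bin_entropy s * real m)" .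
  qed
  finally show "real (num_users s m) \<le> 2 powr (bin_entropy s * real m)" .
qed

text \<open>The 5 bits are 1 for the two parts of the sum, 2 for the lower bound on \<open>M\<close>
  and 2 for the constant \<open>3 \<le> 4\<close>. The 3 bits come from the factor 8 in
  \<open>avg_guesswork_ge\<close>, and \<open>2 / m\<close> inside the minimum from the lower bound
  on \<open>M\<close>.\<close>

lemma (in remote_attack) log_avg_guesswork_bounds:
  assumes s: "1 / 2 \<le> s" "s \<le> 1" and m: "1 \<le> m" and M: "M = num_users s m"
    and t: "t = max s (1 - p)"
    and h: "2 powr (real m * h) \<le> real (m choose nat \<lceil>t * real m\<rceil>)"
  shows "1 / real m * log 2 (avg_guesswork_remote n m p M b \<sigma>)
      \<le> bin_entropy t + cross_entropy t p - bin_entropy s + 5 / real m"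
    and "min (bin_entropy s - 2 / real m) h + cross_entropy t p - bin_entropy s - 3 / real m
      \<le> 1 / real m * log 2 (avg_guesswork_remote n m p M b \<sigma>)"
proof -
  let ?A = "avg_guesswork_remote n m p M b \<sigma>"
  let ?S = "\<Sum>u = 1..M. 1 / \<pi> u"
  let ?H = "bin_entropy s * real m"
  let ?w = "nat \<lceil>t * real m\<rceil>"
  have M_bounds: "2 powr (?H - 2) \<le> real M" "real M \<le> 2 powr ?H"
    using num_users_bounds[OF s] M by auto
  have mean: "mean_inverse_prob = ?S / real M"
    by (simp add: mean_inverse_prob_def)
  have mean_pos: "0 < mean_inverse_prob"
    using M_le_mean_inverse_prob M_pos by linarith
  then have A_pos: "0 < ?A" using avg_guesswork_ge by linarith
  have "?S = (\<Sum>x\<in>b ` {1..M}. 1 / P_K m p x)"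
    using inj_on_bins by (simp add: sum.reindex)
  also have "\<dots> \<le> 2 * 2 powr (real m * (bin_entropy t + cross_entropy t p))"
  proof (rule sum_inverse_P_K_le[OF p_pos p_le s m _ _ t])
    show "b ` {1..M} \<subseteq> bins m" using bin_in_bins by auto
    show "real (card (b ` {1..M})) \<le> 2 powr ?H"
      using M_bounds inj_on_bins by (simp add: card_image)
  qed
  finally have "mean_inverse_prob \<le> 2 * 2 powr (real m * (bin_entropy t + cross_entropy t p)) / 2 powr (?H - 2)"
    unfolding mean using M_bounds(1) by (intro frac_le) auto
  also have "\<dots> = 2 powr (1 + real m * (bin_entropy t + cross_entropy t p) - (?H - 2))"
    by (simp add: powr_diff powr_add)
  finally have "?A \<le> 2 powr 2 * 2 powr (1 + real m * (bin_entropy t + cross_entropy t p) - (?H - 2))"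
    using avg_guesswork_le mean_pos by simp
  also have "\<dots> = 2 powr (real m * (bin_entropy t + cross_entropy t p - bin_entropy s) + 5)"
    by (simp only: powr_add[symmetric]) (simp add: algebra_simps)
  finally have "log 2 ?A \<le> real m * (bin_entropy t + cross_entropy t p - bin_entropy s) + 5"
    using A_pos by (simp add: log_le_iff)
  then show "1 / real m * log 2 ?A \<le> bin_entropy t + cross_entropy t p - bin_entropy s + 5 / real m"
    using m by (simp add: field_simps)
  have tm: "0 \<le> t" "t \<le> 1" using t s p_pos by auto
  \<comment> \<open>Rounding up keeps the fraction of ones at least \<open>t\<close>, the direction
    required by \<open>cross_entropy_mono\<close>.\<close>
  then have w: "?w \<le> m" "t * real m \<le> real ?w"
    using m by (auto simp: nat_le_iff ceiling_le_iff mult_left_le_one_le of_nat_nat)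
  have "2 powr (real m * min (bin_entropy s - 2 / real m) h) \<le> real (min M (m choose ?w))"
  proof -
    have "2 powr (real m * min (bin_entropy s - 2 / real m) h) \<le> 2 powr (real m * (bin_entropy s - 2 / real m))"
      by (intro powr_mono mult_left_mono) auto
    also have "\<dots> = 2 powr (?H - 2)" using m by (simp add: right_diff_distrib mult.commute)
    also note M_bounds(1)
    finally have 1: "2 powr (real m * min (bin_entropy s - 2 / real m) h) \<le> real M" .
    have "2 powr (real m * min (bin_entropy s - 2 / real m) h) \<le> 2 powr (real m * h)"
      by (intro powr_mono mult_left_mono) auto
    also note h
    finally show ?thesis using 1 by (simp add: min_def)
  qed
  moreover have "cross_entropy t p \<le> cross_entropy (real ?w / real m) p"
    using w m by (intro cross_entropy_mono p_pos p_le) (simp add: field_simps)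
  then have "2 powr (real m * cross_entropy t p) \<le> 2 powr (real m * cross_entropy (real ?w / real m) p)"
    by (intro powr_mono mult_left_mono) auto
  ultimately have "2 powr (real m * min (bin_entropy s - 2 / real m) h) * 2 powr (real m * cross_entropy t p)
      \<le> real (min M (m choose ?w)) * 2 powr (real m * cross_entropy (real ?w / real m) p)"
    by (intro mult_mono) auto
  also have "\<dots> \<le> ?S"
    using w(1) m by (rule sum_inverse_prob_ge)
  finally have "2 powr (real m * min (bin_entropy s - 2 / real m) h) * 2 powr (real m * cross_entropy t p) / 2 powr ?H
      \<le> mean_inverse_prob"
    unfolding mean using M_bounds(2) M_pos by (intro frac_le sum_nonneg) (auto simp: P_K_def)
  also have "\<dots> \<le> 2 powr 3 * ?A"
    using avg_guesswork_ge by simp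
  finally have "2 powr (real m * min (bin_entropy s - 2 / real m) h + real m * cross_entropy t p - ?H - 3) \<le> ?A"
    by (simp add: powr_diff powr_add)
  then have "real m * min (bin_entropy s - 2 / real m) h + real m * cross_entropy t p - ?H - 3 \<le> log 2 ?A"
    using A_pos by (simp add: le_log_iff)
  then have "real m * (min (bin_entropy s - 2 / real m) h + cross_entropy t p - bin_entropy s - 3 / real m)
      \<le> log 2 ?A"
    using m by (simp add: algebra_simps)
  then show "min (bin_entropy s - 2 / real m) h + cross_entropy t p - bin_entropy s - 3 / real m
      \<le> 1 / real m * log 2 ?A"
    using m by (simp add: field_simps)
qed

theorem theorem11:
  fixes p s \<epsilon>\<^sub>1 :: real
    and n :: "nat \<Rightarrow> nat"
    and b :: "nat \<Rightarrow> nat \<Rightarrow> bool list"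
    and \<sigma> :: "nat \<Rightarrow> nat \<Rightarrow> nat"
  assumes "0 < p" and "p \<le> 1 / 2"
    and "1 / 2 \<le> s" and "s \<le> 1"
    and "0 < \<epsilon>\<^sub>1"
    and "\<And>m. 1 \<le> m \<Longrightarrow> (1 + \<epsilon>\<^sub>1) * real m * log 2 (1 / p) \<le> real (n m)"
    and "\<And>m. 1 \<le> m \<Longrightarrow> bin_ordering m p (b m)"
    and "\<And>m. 1 \<le> m \<Longrightarrow> bij_betw (\<sigma> m) {1..2 ^ n m} {1..2 ^ n m}"
  shows "(1 - p \<le> s \<longrightarrow>
           (\<lambda>m. 1 / real m * log 2 (avg_guesswork_remote (n m) m p (num_users s m) (b m) (\<sigma> m)))
             \<longlonglongrightarrow> bin_entropy s + bin_divergence s p) \<and>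
         (s \<le> 1 - p \<longrightarrow>
           (\<lambda>m. 1 / real m * log 2 (avg_guesswork_remote (n m) m p (num_users s m) (b m) (\<sigma> m)))
             \<longlonglongrightarrow> 2 * bin_entropy p + bin_divergence (1 - p) p - bin_entropy s)"
proof -
  define t where "t = max s (1 - p)"
  let ?a = "\<lambda>m. 1 / real m * log 2 (avg_guesswork_remote (n m) m p (num_users s m) (b m) (\<sigma> m))"
  have t: "1 / 2 \<le> s" "s \<le> t" "0 < t" "t \<le> 1" using assms by (auto simp: t_def)
  obtain h where h: "h \<longlonglongrightarrow> bin_entropy t"
      "\<forall>\<^sub>F m in sequentially. 2 powr (real m * h m) \<le> real (m choose nat \<lceil>t * real m\<rceil>)"
    using choose_exponent[of t] t by auto
  have attack: "remote_attack (n m) m (num_users s m) p (b m) (\<sigma> m)" if m: "1 \<le> m" for m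
  proof
    have "real (num_users s m) \<le> 2 powr (bin_entropy s * real m)"
      using num_users_bounds assms by auto
    also have "\<dots> \<le> 2 powr real m"
      using bin_entropy_bounds[of s] assms by (intro powr_mono mult_left_le_one_le) auto
    also have "\<dots> = real (2 ^ m)" by (simp add: powr_realpow)
    finally show "num_users s m \<le> 2 ^ m" by (simp only: of_nat_le_iff)
    \<comment> \<open>The rest derives \<open>key_long\<close> by exponentiating the length
      condition on \<open>n m\<close>.\<close>
    have log_nonneg: "0 \<le> log 2 (1 / p)" using assms by simp
    then have "real m * log 2 (1 / p) \<le> (1 + \<epsilon>\<^sub>1) * (real m * log 2 (1 / p))"
      using \<open>0 < \<epsilon>\<^sub>1\<close> by (simp add: algebra_simps)
    then have "2 powr (real m * log 2 (1 / p)) \<le> 2 powr real (n m)"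
      using assms(6)[OF m] by (intro powr_mono) (auto simp: mult.assoc)
    moreover have "2 powr (real m * log 2 (1 / p)) = (1 / p) ^ m"
      using assms by (subst mult.commute, subst powr_powr[symmetric]) (simp add: powr_realpow)
    ultimately show "1 \<le> 2 ^ n m * p ^ m"
      using assms by (simp add: powr_realpow power_divide field_simps)
  qed (use assms m num_users_bounds in auto)
  have "?a \<longlonglongrightarrow> bin_entropy t + cross_entropy t p - bin_entropy s"
  proof (rule tendsto_sandwich)
    show "\<forall>\<^sub>F m in sequentially.
        min (bin_entropy s - 2 / real m) (h m) + cross_entropy t p - bin_entropy s - 3 / real m \<le> ?a m"
      using h(2) eventually_ge_at_top[of 1]
      by eventually_elim
        (use remote_attack.log_avg_guesswork_bounds(2)[OF attack] assms t_def in blast)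
    show "\<forall>\<^sub>F m in sequentially.
        ?a m \<le> bin_entropy t + cross_entropy t p - bin_entropy s + 5 / real m"
      using h(2) eventually_ge_at_top[of 1]
      by eventually_elim
        (use remote_attack.log_avg_guesswork_bounds(1)[OF attack] assms t_def in blast)
    have inv: "(\<lambda>m. c / real m) \<longlonglongrightarrow> 0" for c
      by (rule lim_const_over_n)
    \<comment> \<open>The minimum of \<open>M\<close> and the binomial coefficient is decided in the
      limit by \<open>bin_entropy t\<close>, since entropy decreases from \<open>s\<close> to
      \<open>t\<close>.\<close>
    have "(\<lambda>m. min (bin_entropy s - 2 / real m) (h m) + cross_entropy t p - bin_entropy s - 3 / real m)
        \<longlonglongrightarrow> min (bin_entropy s - 0) (bin_entropy t) + cross_entropy t p - bin_entropy s - 0"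
      by (intro tendsto_intros inv h(1))
    moreover have "bin_entropy t \<le> bin_entropy s"
      using t by (intro bin_entropy_antimono) auto
    ultimately show "(\<lambda>m. min (bin_entropy s - 2 / real m) (h m) + cross_entropy t p - bin_entropy s - 3 / real m)
        \<longlonglongrightarrow> bin_entropy t + cross_entropy t p - bin_entropy s"
      by simp
    show "(\<lambda>m. bin_entropy t + cross_entropy t p - bin_entropy s + 5 / real m)
        \<longlonglongrightarrow> bin_entropy t + cross_entropy t p - bin_entropy s"
      using tendsto_add[OF tendsto_const inv, of "bin_entropy t + cross_entropy t p - bin_entropy s" 5] by simp
  qed
  \<comment> \<open>The limit becomes
    \<open>2 * bin_entropy t + bin_divergence t p - bin_entropy s\<close>, which specialises to both
    cases.\<close>
  moreover have "cross_entropy t p = bin_entropy t + bin_divergence t p"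
    using t assms by (intro cross_entropy_eq) auto
  moreover have "t = s" if "1 - p \<le> s" using that by (simp add: t_def)
  moreover have "t = 1 - p" if "s \<le> 1 - p" using that by (simp add: t_def)
  ultimately show ?thesis
    by (auto simp: bin_entropy_symmetric)
qed

end
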